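(* Let $K\ge1$, let $c\in[0,\infty)^K$, let $n=\sum_{i=1}^K c_i$, and let $j\in\{1,\dots,K\}$ be such that $c_j=m>0$. Then $$\operatorname{TV}\bigl(\operatorname{Dir}(c),\operatorname{Dir}(c+e_j)\bigr)\le\frac12\sqrt{\frac{n-m}{m(n+1)}}\le\frac1{2\sqrt m}.$$
   Context: $e_1,\dots,e_K$ are the standard basis vectors of $\mathbb R^K$, and $\Delta_K=\{p\in\mathbb R^K: p_i\ge 0,\ \sum_i p_i=1\}$. $\operatorname{TV}(\mu,\nu)=\sup_B|\mu(B)-\nu(B)|$ is the total variation distance between probability measures (equal to half the $L^1$ distance of densities with respect to a common dominating measure). For a nonzero vector $\alpha\in[0,\infty)^K$ (real entries, zeros allowed) let $A=\{i:\alpha_i>0\}$. The law $\operatorname{Dir}(\alpha)$ is the distribution of the random vector $P\in\Delta_K$ obtained by drawing independent $G_i\sim\mathrm{Gamma}(\alpha_i,1)$ for $i\in A$, setting $P_i=G_i/\sum_{k\in A}G_k$ for $i\in A$ and $P_i=0$ for $i\notin A$ (so it is supported on the face spanned by $\{e_i:i\in A\}$; if $A=\{i\}$ it is the point mass at $e_i$). *)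

theory Defs
  imports "HOL-Probability.Probability"
begin

text \<open>Total variation distance, intended for probability measures on a common
  \<open>\<sigma>\<close>-algebra; there the supremum is over a nonempty set bounded by 1.\<close>

definition tv_dist :: "'a measure \<Rightarrow> 'a measure \<Rightarrow> real" where
  "tv_dist \<mu> \<nu> = (SUP B \<in> sets \<mu>. \<bar>measure \<mu> B - measure \<nu> B\<bar>)"

text \<open>Gamma distribution with real shape \<open>a > 0\<close> and rate 1.\<close>

definition gamma_density :: "real \<Rightarrow> real \<Rightarrow> real" where
  "gamma_density a x = (if x > 0 then x powr (a - 1) * exp (- x) / Gamma a else 0)"

definition gamma_measure :: "real \<Rightarrow> real measure" where
  "gamma_measure a = density lborel (\<lambda>x. ennreal (gamma_density a x))"

text \<open>For \<open>\<alpha> \<noteq> 0\<close> with nonnegative entries, this is the Dirichlet law, regarded as a Borel measure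
  on the whole space rather than on the simplex. Coordinates outside \<open>A\<close> are identically zero;
  the denominator is positive almost surely, so the convention \<open>x / 0 = 0\<close> matters only on
  a null set. For \<open>\<alpha> = 0\<close> it degenerates to the point mass at 0.\<close>

definition dirichlet :: "real ^ 'k \<Rightarrow> (real ^ 'k) measure" where
  "dirichlet \<alpha> =
    (let A = {i. \<alpha> $ i > 0} in
      distr (\<Pi>\<^sub>M i\<in>A. gamma_measure (\<alpha> $ i)) borel
        (\<lambda>G. \<chi> i. if i \<in> A then G i / (\<Sum>k\<in>A. G k) else 0))"

lemma prob_space_gamma_measure:
  assumes "a > 0"
  shows "prob_space (gamma_measure a)"
proof
  have "(\<integral>\<^sup>+ x. ennreal (gamma_density a x) \<partial>lborel)
      = (\<integral>\<^sup>+ x. ennreal (1 / Gamma a) * ennreal (indicator {0..} x * x powr (a - 1) / exp (1 * x)) \<partial>lborel)"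
    using assms
    by (intro nn_integral_cong)
       (auto simp: gamma_density_def indicator_def exp_minus field_simps
          Gamma_real_pos less_imp_le simp flip: ennreal_mult)
  also have "\<dots> = ennreal (1 / Gamma a) * ennreal (Gamma a)"
    using assms by (subst nn_integral_cmult) (simp_all add: Gamma_conv_nn_integral_real)
  also have "\<dots> = 1"
    using Gamma_real_pos[OF assms] by (simp flip: ennreal_mult)
  finally show "emeasure (gamma_measure a) (space (gamma_measure a)) = 1"
    by (simp add: gamma_measure_def emeasure_density gamma_density_def[abs_def])
qed

lemma prob_space_dirichlet: "prob_space (dirichlet \<alpha>)"
proof -
  let ?A = "{i. \<alpha> $ i > 0}"
  let ?M = "\<Pi>\<^sub>M i\<in>?A. gamma_measure (\<alpha> $ i)"
  let ?f = "\<lambda>G. \<chi> i. if i \<in> ?A then G i / (\<Sum>k\<in>?A. G k) else 0"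
  have sets: "sets (gamma_measure a) = sets borel" for a
    by (simp add: gamma_measure_def)
  have comp: "(\<lambda>G. G i) \<in> borel_measurable ?M" if "i \<in> ?A" for i
    using measurable_component_singleton[OF that, of "\<lambda>i. gamma_measure (\<alpha> $ i)"]
    by (simp cong: measurable_cong_sets add: sets)
  have "(\<lambda>G. if i \<in> ?A then G i / (\<Sum>k\<in>?A. G k) else 0) \<in> borel_measurable ?M" for i
    using comp by (cases "i \<in> ?A") (auto intro!: borel_measurable_divide borel_measurable_sum)
  then have "?f \<in> borel_measurable ?M"
    by (subst borel_measurable_euclidean_space) (auto simp: Basis_vec_def inner_axis)
  moreover have "prob_space ?M"
    by (rule prob_space_PiM) (simp add: prob_space_gamma_measure)
  ultimately show ?thesis
    unfolding dirichlet_def Let_def by (rule prob_space.prob_space_distr[rotated])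
qed

end

theory Submission
  imports Defs
begin

text \<open>Since \<open>Gamma(m + 1)\<close> has density \<open>x / m\<close> with respect to \<open>Gamma(m)\<close>, passing from
  \<open>c\<close> to \<open>c + e\<^sub>j\<close> weights the product of gamma laws by \<open>G\<^sub>j / m = S P\<^sub>j / m\<close>, where
  \<open>S\<close> is the sum of the \<open>G\<^sub>i\<close>. Rescaling \<open>G\<close> gives \<open>E[exp(-t S) h] = (1 + t)\<^bsup>-n\<^esup> E[h]\<close> for
  every \<open>h\<close> that is homogeneous of degree 0, and differentiating at \<open>t = 0\<close> gives
  \<open>E[S h] = n E[h]\<close>. Hence \<open>Dir(c + e\<^sub>j)\<close> has density \<open>n p\<^sub>j / m\<close> with respect to
  \<open>Dir(c)\<close>, which also yields the first two moments of \<open>p\<^sub>j\<close>. The variable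
  \<open>Z = 1 - n p\<^sub>j / m\<close> is centred with second moment \<open>(n - m) / (m (n + 1))\<close>, and
  \<open>E[Z 1\<^sub>B] = E[Z (1\<^sub>B - 1/2)]\<close> is at most \<open>sqrt(E[Z\<^sup>2]) / 2\<close> in absolute value
  because \<open>1\<^sub>B - 1/2\<close> has absolute value \<open>1/2\<close>.\<close>

section \<open>Densities on finite products\<close>

text \<open>Both sides agree on boxes: there the integral of a product of one-coordinate functions
  factors, and finite product measures are determined by boxes.\<close>

lemma PiM_density:
  assumes "finite I"
    and M: "\<And>i. i \<in> I \<Longrightarrow> prob_space (M i)"
    and D: "\<And>i. i \<in> I \<Longrightarrow> prob_space (density (M i) (f i))"
    and f: "\<And>i. i \<in> I \<Longrightarrow> f i \<in> borel_measurable (M i)"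
  shows "PiM I (\<lambda>i. density (M i) (f i)) = density (PiM I M) (\<lambda>x. \<Prod>i\<in>I. f i (x i))"
proof -
  \<comment> \<open>The locale \<open>product_prob_space\<close> asks for a probability space at
    every index, so both families are padded outside \<open>I\<close> by a point mass.\<close>
  define N where "N = (\<lambda>i. if i \<in> I then M i else return (count_space UNIV) undefined)"
  define N' where "N' = (\<lambda>i. if i \<in> I then density (M i) (f i) else return (count_space UNIV) undefined)"
  have N: "PiM I M = PiM I N" and N': "PiM I (\<lambda>i. density (M i) (f i)) = PiM I N'"
    by (auto simp: N_def N'_def intro!: PiM_cong)
  have "prob_space (N i)" "prob_space (N' i)" for i
    by (auto simp: N_def N'_def M D intro!: prob_space_return)
  then interpret N: product_prob_space N + N': product_prob_space N'
    by (simp_all add: product_prob_spaceI)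
  have f': "f i \<in> borel_measurable (N i)" if "i \<in> I" for i
    using f[OF that] that by (simp add: N_def)
  have fx [measurable]: "(\<lambda>x. f i (x i)) \<in> borel_measurable (PiM I N)" if "i \<in> I" for i
    using measurable_component_singleton[OF that, of N] f'[OF that] by (rule measurable_compose)
  have "density (PiM I N) (\<lambda>x. \<Prod>i\<in>I. f i (x i)) = PiM I N'"
  proof (rule N'.PiM_eqI)
    show "sets (density (PiM I N) (\<lambda>x. \<Prod>i\<in>I. f i (x i))) = sets (PiM I N')"
      by (simp, rule sets_PiM_cong) (auto simp: N_def N'_def)
  next
    fix A assume "\<And>i. i \<in> I \<Longrightarrow> A i \<in> sets (N' i)"
    then have A: "A i \<in> sets (N i)" if "i \<in> I" for i
      using that by (auto simp: N_def N'_def)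
    \<comment> \<open>Points of the product space are already extensional, so membership in the box
      is a purely coordinatewise condition.\<close>
    have ind: "indicator (Pi\<^sub>E I A) x = (\<Prod>i\<in>I. indicator (A i) (x i) :: ennreal)"
      if "x \<in> space (PiM I N)" for x
      using that \<open>finite I\<close>
      by (auto simp: space_PiM PiE_def Pi_def indicator_def prod_zero_iff intro!: prod.neutral[symmetric])
    have "emeasure (density (PiM I N) (\<lambda>x. \<Prod>i\<in>I. f i (x i))) (Pi\<^sub>E I A)
        = (\<integral>\<^sup>+x. (\<Prod>i\<in>I. f i (x i)) * indicator (Pi\<^sub>E I A) x \<partial>PiM I N)"
      using A \<open>finite I\<close> fx by (intro emeasure_density sets_PiM_I_finite) auto
    also have "\<dots> = (\<integral>\<^sup>+x. (\<Prod>i\<in>I. f i (x i) * indicator (A i) (x i)) \<partial>PiM I N)"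
      by (intro nn_integral_cong) (simp add: ind prod.distrib)
    also have "\<dots> = (\<Prod>i\<in>I. \<integral>\<^sup>+y. f i y * indicator (A i) y \<partial>N i)"
      using A f' \<open>finite I\<close> by (intro N.product_nn_integral_prod) auto
    also have "\<dots> = (\<Prod>i\<in>I. emeasure (N' i) (A i))"
      using A f by (intro prod.cong) (auto simp: N_def N'_def emeasure_density)
    finally show "emeasure (density (PiM I N) (\<lambda>x. \<Prod>i\<in>I. f i (x i))) (Pi\<^sub>E I A)
        = (\<Prod>i\<in>I. emeasure (N' i) (A i))" .
  qed (fact \<open>finite I\<close>)
  then show ?thesis by (simp add: N N')
qed

section \<open>One gamma law: raising the shape and rescaling\<close>

lemma gamma_density_measurable [measurable]: "gamma_density a \<in> borel_measurable borel"
  by (simp add: gamma_density_def [abs_def])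

lemma gamma_density_nonneg: "a > 0 \<Longrightarrow> gamma_density a x \<ge> 0"
  using Gamma_real_pos[of a] by (simp add: gamma_density_def)

lemma sets_gamma_measure [simp, measurable_cong]: "sets (gamma_measure a) = sets borel"
  by (simp add: gamma_measure_def)

lemma space_gamma_measure [simp]: "space (gamma_measure a) = UNIV"
  by (simp add: gamma_measure_def)

lemma AE_gamma_measure_pos: "AE x in gamma_measure a. 0 < x"
  unfolding gamma_measure_def by (subst AE_density) (auto simp: gamma_density_def)

text \<open>The extra factor \<open>x\<close> in the density is normalised by
  \<open>Gamma (a + 1) = a * Gamma a\<close>.\<close>

lemma gamma_measure_add_1:
  assumes "a > 0"
  shows "gamma_measure (a + 1) = density (gamma_measure a) (\<lambda>x. ennreal (x / a))"
proof -
  have "gamma_density (a + 1) x = gamma_density a x * (x / a)" for x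
    using assms Gamma_real_pos[OF assms]
    by (auto simp: gamma_density_def Gamma_plus1[of a] plus_of_nat_eq_0_imp powr_diff nonpos_Ints_def)
  then show ?thesis
    using gamma_density_nonneg[OF assms] unfolding gamma_measure_def
    by (subst density_density_eq) (auto simp: ennreal_mult' simp del: times_divide_eq_right)
qed

text \<open>Substituting \<open>s * x\<close> turns \<open>exp (- x)\<close> into
  \<open>exp (- x) * exp (- (s - 1) * x)\<close>, and the Jacobian \<open>s\<close> joins
  \<open>s powr (a - 1)\<close>. Rescaling is thus an exponential tilt.\<close>

lemma distr_gamma_measure_scale:
  assumes "a > 0" "s > 0"
  shows "distr (gamma_measure a) borel (\<lambda>x. x / s)
    = density (gamma_measure a) (\<lambda>x. ennreal (s powr a * exp (- (s - 1) * x)))"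
proof (rule measure_eqI)
  fix X :: "real set" assume "X \<in> sets (distr (gamma_measure a) borel (\<lambda>x. x / s))"
  then have [measurable]: "X \<in> sets borel" by simp
  have scale: "s * gamma_density a (s * x) = gamma_density a x * (s powr a * exp (- (s - 1) * x))" for x
    using \<open>s > 0\<close>
    by (auto simp: gamma_density_def powr_mult powr_diff zero_less_mult_iff algebra_simps
        simp flip: exp_add)
  have "emeasure (distr (gamma_measure a) borel (\<lambda>x. x / s)) X
      = (\<integral>\<^sup>+x. indicator X (x / s) \<partial>gamma_measure a)"
    by (simp add: nn_integral_distr flip: nn_integral_indicator)
  also have "\<dots> = (\<integral>\<^sup>+x. ennreal (gamma_density a x) * indicator X (x / s) \<partial>lborel)"
    by (simp add: gamma_measure_def nn_integral_density)
  also have "\<dots> = ennreal s * (\<integral>\<^sup>+x. ennreal (gamma_density a (s * x)) * indicator X x \<partial>lborel)"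
    using \<open>s > 0\<close> by (subst nn_integral_real_affine[of _ s 0]) auto
  also have "\<dots> = (\<integral>\<^sup>+x. ennreal (s * gamma_density a (s * x)) * indicator X x \<partial>lborel)"
    using \<open>s > 0\<close> by (subst nn_integral_cmult [symmetric]) (auto simp: ennreal_mult' mult.assoc)
  also have "\<dots> = (\<integral>\<^sup>+x. ennreal (gamma_density a x)
      * (ennreal (s powr a * exp (- (s - 1) * x)) * indicator X x) \<partial>lborel)"
    unfolding scale by (intro nn_integral_cong) (simp add: gamma_density_nonneg \<open>a > 0\<close> ennreal_mult mult.assoc)
  also have "\<dots> = emeasure (density (gamma_measure a) (\<lambda>x. ennreal (s powr a * exp (- (s - 1) * x)))) X"
    by (simp add: emeasure_density gamma_measure_def nn_integral_density)
  finally show "emeasure (distr (gamma_measure a) borel (\<lambda>x. x / s)) X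
    = emeasure (density (gamma_measure a) (\<lambda>x. ennreal (s powr a * exp (- (s - 1) * x)))) X" .
qed simp

section \<open>Products of gamma laws: raising one shape and exponential tilts\<close>

text \<open>Only the factor at \<open>j\<close> changes; every other coordinate gets density
  1.\<close>

lemma PiM_gamma_measure_add_1:
  assumes "finite A" "j \<in> A" "\<And>i. i \<in> A \<Longrightarrow> a i > 0"
  shows "PiM A (\<lambda>i. gamma_measure ((a(j := a j + 1)) i))
    = density (PiM A (\<lambda>i. gamma_measure (a i))) (\<lambda>G. ennreal (G j / a j))"
proof -
  let ?f = "\<lambda>i x. if i = j then ennreal (x / a j) else 1"
  have eq: "gamma_measure ((a(j := a j + 1)) i) = density (gamma_measure (a i)) (?f i)" if "i \<in> A" for i
    using assms that by (auto simp: gamma_measure_add_1 density_1)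
  have "PiM A (\<lambda>i. gamma_measure ((a(j := a j + 1)) i)) = PiM A (\<lambda>i. density (gamma_measure (a i)) (?f i))"
    using eq by (intro PiM_cong) auto
  also have "\<dots> = density (PiM A (\<lambda>i. gamma_measure (a i))) (\<lambda>G. \<Prod>i\<in>A. ?f i (G i))"
  proof (rule PiM_density)
    show "prob_space (density (gamma_measure (a i)) (?f i))" if "i \<in> A" for i
      unfolding eq[OF that, symmetric] using assms(3)[OF that] by (intro prob_space_gamma_measure) auto
  qed (use assms in \<open>auto intro: prob_space_gamma_measure\<close>)
  also have "(\<lambda>G. \<Prod>i\<in>A. ?f i (G i)) = (\<lambda>G. ennreal (G j / a j))"
    using assms by (auto simp: prod.delta)
  finally show ?thesis .
qed

text \<open>Dividing all coordinates by \<open>s\<close> leaves \<open>h\<close> unchanged, while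
  the coordinatewise tilts multiply to a function of the sum of the coordinates alone.\<close>

lemma integral_PiM_gamma_laplace:
  fixes a :: "'i \<Rightarrow> real"
  assumes "finite A" "\<And>i. i \<in> A \<Longrightarrow> a i > 0" "s > 0"
  assumes [measurable]: "h \<in> borel_measurable (PiM A (\<lambda>_. borel))"
    and homogeneous: "\<And>G. h (compose A (\<lambda>x. x / s) G) = h G"
  shows "(\<integral>G. exp (- (s - 1) * (\<Sum>i\<in>A. G i)) * h G \<partial>PiM A (\<lambda>i. gamma_measure (a i)))
      = s powr (- (\<Sum>i\<in>A. a i)) * (\<integral>G. h G \<partial>PiM A (\<lambda>i. gamma_measure (a i)))"
proof -
  let ?M = "PiM A (\<lambda>i. gamma_measure (a i))" and ?B = "PiM A (\<lambda>_. borel :: real measure)"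
  let ?f = "\<lambda>i x. ennreal (s powr a i * exp (- (s - 1) * x))"
  have [measurable_cong]: "sets ?M = sets ?B"
    by (intro sets_PiM_cong) auto
  have prob: "prob_space (gamma_measure (a i))" if "i \<in> A" for i
    using assms(2)[OF that] by (rule prob_space_gamma_measure)
  have eq: "distr (gamma_measure (a i)) borel (\<lambda>x. x / s) = density (gamma_measure (a i)) (?f i)"
    if "i \<in> A" for i
    using assms that by (intro distr_gamma_measure_scale) auto
  \<comment> \<open>The image of the product is computed with the gamma laws themselves as targets;
    only their Borel \<sigma>-algebra matters for \<open>distr\<close>.\<close>
  have "distr ?M ?B (compose A (\<lambda>x. x / s)) = distr ?M ?M (compose A (\<lambda>x. x / s))"
    by (intro distr_cong refl sets_PiM_cong) simp
  also have "\<dots> = PiM A (\<lambda>i. distr (gamma_measure (a i)) (gamma_measure (a i)) (\<lambda>x. x / s))"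
    using assms prob by (intro distr_PiM_finite_prob_space') auto
  also have "\<dots> = PiM A (\<lambda>i. density (gamma_measure (a i)) (?f i))"
    by (intro PiM_cong refl, subst eq [symmetric]) (auto intro: distr_cong)
  also have "\<dots> = density ?M (\<lambda>G. \<Prod>i\<in>A. ?f i (G i))"
  proof (rule PiM_density)
    show "prob_space (density (gamma_measure (a i)) (?f i))" if "i \<in> A" for i
      unfolding eq[OF that, symmetric] by (intro prob_space.prob_space_distr prob that) auto
  qed (use assms prob in auto)
  also have "(\<lambda>G. \<Prod>i\<in>A. ?f i (G i))
      = (\<lambda>G. ennreal (s powr (\<Sum>i\<in>A. a i) * exp (- (s - 1) * (\<Sum>i\<in>A. G i))))"
    using assms by (simp add: prod_ennreal prod.distrib powr_sum exp_sum sum_distrib_left sum_negf)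
  finally have *: "distr ?M ?B (compose A (\<lambda>x. x / s))
    = density ?M (\<lambda>G. ennreal (s powr (\<Sum>i\<in>A. a i) * exp (- (s - 1) * (\<Sum>i\<in>A. G i))))" .
  have [measurable]: "compose A (\<lambda>x. x / s) \<in> measurable ?M ?B"
    unfolding compose_def by (intro measurable_restrict) (simp cong: measurable_cong_sets)
  have "(\<integral>G. h G \<partial>?M) = (\<integral>G. h G \<partial>distr ?M ?B (compose A (\<lambda>x. x / s)))"
    by (subst integral_distr) (auto simp: homogeneous)
  also have "\<dots> = s powr (\<Sum>i\<in>A. a i) * (\<integral>G. exp (- (s - 1) * (\<Sum>i\<in>A. G i)) * h G \<partial>?M)"
    unfolding * by (subst integral_density) (auto simp: mult.assoc)
  finally show ?thesis
    using \<open>s > 0\<close> by (simp add: powr_minus field_simps)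
qed


section \<open>The sum of the coordinates against scale-invariant functions\<close>

text \<open>Sampling the derivative along a sequence lets dominated convergence apply. The step
  \<open>inverse (real (Suc k))\<close> is never 0.\<close>

lemma difference_quotient_sequentially:
  assumes "(f has_real_derivative D) (at 0)"
  shows "(\<lambda>k. (f (inverse (real (Suc k))) - f 0) / inverse (real (Suc k))) \<longlonglongrightarrow> D"
proof -
  have "((\<lambda>t. (f t - f 0) / t) \<longlongrightarrow> D) (at 0)"
    using assms by (simp add: DERIV_def)
  moreover have "filterlim (\<lambda>k. inverse (real (Suc k))) (at 0) sequentially"
    using LIMSEQ_inverse_real_of_nat by (auto simp: filterlim_at)
  ultimately show ?thesis by (rule filterlim_compose)
qed

text \<open>Up to the factor \<open>a j\<close>, the coordinate is the density of another
  probability measure, the product with shape \<open>a j + 1\<close> at \<open>j\<close>; hence its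
  integral is finite.\<close>

lemma integrable_PiM_gamma_component:
  assumes "finite A" "j \<in> A" "\<And>i. i \<in> A \<Longrightarrow> a i > 0"
  shows "integrable (PiM A (\<lambda>i. gamma_measure (a i))) (\<lambda>G. G j)"
proof -
  let ?M = "PiM A (\<lambda>i. gamma_measure (a i))"
  have [measurable_cong]: "sets ?M = sets (PiM A (\<lambda>_. borel))"
    by (intro sets_PiM_cong) auto
  interpret D: prob_space "density ?M (\<lambda>G. ennreal (G j / a j))"
    using prob_space_PiM[of A "\<lambda>i. gamma_measure ((a(j := a j + 1)) i)"] assms
    by (subst PiM_gamma_measure_add_1[OF assms, symmetric])
       (auto intro!: prob_space_gamma_measure prob_space_PiM simp: add_pos_pos)
  have [measurable]: "(\<lambda>G. G j) \<in> borel_measurable ?M"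
    using \<open>j \<in> A\<close> by measurable
  have "AE G in ?M. 0 < G j"
    using assms
    by (intro AE_PiM_component[where P = "\<lambda>x. 0 < x" and M = "\<lambda>i. gamma_measure (a i)"])
       (auto intro: prob_space_gamma_measure AE_gamma_measure_pos)
  then have nonneg: "AE G in ?M. 0 \<le> G j / a j"
    by eventually_elim (use assms in \<open>simp add: less_imp_le\<close>)
  have "integrable (density ?M (\<lambda>G. ennreal (G j / a j))) (\<lambda>_. 1 :: real)"
    by simp
  then have "integrable ?M (\<lambda>G. G j / a j)"
    by (subst (asm) integrable_density) (use nonneg in auto)
  then have "integrable ?M (\<lambda>G. a j * (G j / a j))"
    by (rule integrable_mult_right)
  then show ?thesis
    using assms(3)[OF \<open>j \<in> A\<close>] by auto
qed

lemma AE_PiM_gamma_pos: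
  assumes "finite A" "\<And>i. i \<in> A \<Longrightarrow> a i > 0"
  shows "AE G in PiM A (\<lambda>i. gamma_measure (a i)). \<forall>i\<in>A. 0 < G i"
  using assms
  by (intro AE_finite_allI AE_PiM_component[where P = "\<lambda>x. 0 < x" and M = "\<lambda>i. gamma_measure (a i)"])
     (auto intro: prob_space_gamma_measure AE_gamma_measure_pos)

text \<open>This replaces the independence of the sum and the normalised vector.\<close>

lemma integral_PiM_gamma_sum_mult:
  fixes a :: "'i \<Rightarrow> real"
  assumes "finite A" "\<And>i. i \<in> A \<Longrightarrow> a i > 0"
  assumes h: "h \<in> borel_measurable (PiM A (\<lambda>_. borel))"
    and homogeneous: "\<And>G s. s > 0 \<Longrightarrow> h (compose A (\<lambda>x. x / s) G) = h G"
    and bounded: "AE G in PiM A (\<lambda>i. gamma_measure (a i)). \<bar>h G\<bar> \<le> C"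
  shows "(\<integral>G. (\<Sum>i\<in>A. G i) * h G \<partial>PiM A (\<lambda>i. gamma_measure (a i)))
    = (\<Sum>i\<in>A. a i) * (\<integral>G. h G \<partial>PiM A (\<lambda>i. gamma_measure (a i)))"
proof -
  let ?M = "PiM A (\<lambda>i. gamma_measure (a i))"
  define S n where "S G = (\<Sum>i\<in>A. G i)" and "n = (\<Sum>i\<in>A. a i)" for G :: "'i \<Rightarrow> real"
  define t where "t k = inverse (real (Suc k))" for k
  have t: "t k > 0" for k by (simp add: t_def)
  have [measurable_cong]: "sets ?M = sets (PiM A (\<lambda>_. borel))"
    by (intro sets_PiM_cong) auto
  note [measurable] = h
  interpret prob_space ?M
    using assms by (intro prob_space_PiM prob_space_gamma_measure)
  have [measurable]: "S \<in> borel_measurable ?M"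
    unfolding S_def by measurable
  have S_int: "integrable ?M S"
    unfolding S_def using assms by (intro Bochner_Integration.integrable_sum integrable_PiM_gamma_component)
  have "AE G in ?M. \<forall>i\<in>A. 0 < G i"
    using assms by (intro AE_PiM_gamma_pos)
  then have S_nonneg: "AE G in ?M. 0 \<le> S G"
    by eventually_elim (simp add: S_def sum_nonneg less_imp_le)
  have h_int: "integrable ?M h"
    using bounded by (intro integrable_const_bound[where B = C]) auto
  have tilt_int: "integrable ?M (\<lambda>G. exp (- t k * S G) * h G)" for k
  proof (rule Bochner_Integration.integrable_bound[OF h_int])
    show "AE G in ?M. norm (exp (- t k * S G) * h G) \<le> norm (h G)"
      using S_nonneg by eventually_elim (use t[of k] in \<open>auto simp: abs_mult intro!: mult_left_le_one_le\<close>)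
  qed measurable
  \<comment> \<open>The derivative at 0 of the map sending \<open>t\<close> to minus the integral of
    \<open>exp (- t * S G) * h G\<close> is computed twice: here under the integral, below from the
    Laplace formula.\<close>
  have "(\<lambda>k. \<integral>G. (1 - exp (- t k * S G)) / t k * h G \<partial>?M) \<longlonglongrightarrow> (\<integral>G. S G * h G \<partial>?M)"
  proof (rule integral_dominated_convergence)
    show "integrable ?M (\<lambda>G. S G * C)" using S_int by simp
    show "AE G in ?M. (\<lambda>k. (1 - exp (- t k * S G)) / t k * h G) \<longlonglongrightarrow> S G * h G"
    proof (intro AE_I2 tendsto_mult_right)
      fix G
      \<comment> \<open>The value at 0 is \<open>-1\<close>, so the difference quotient is exactly
        \<open>(1 - exp (- t * S G)) / t\<close>.\<close>
      have "((\<lambda>t. - exp (- t * S G)) has_real_derivative S G) (at 0)"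
        by (auto intro!: derivative_eq_intros)
      from difference_quotient_sequentially[OF this]
      show "(\<lambda>k. (1 - exp (- t k * S G)) / t k) \<longlonglongrightarrow> S G" by (simp add: t_def)
    qed
    show "AE G in ?M. norm ((1 - exp (- t k * S G)) / t k * h G) \<le> S G * C" for k
      using S_nonneg bounded
    proof eventually_elim
      fix G assume S: "0 \<le> S G" and hC: "\<bar>h G\<bar> \<le> C"
      \<comment> \<open>This bound makes the dominating function \<open>S G * C\<close> independent
        of \<open>k\<close>.\<close>
      have "1 - exp (- t k * S G) \<le> t k * S G"
        using exp_ge_add_one_self[of "- t k * S G"] by simp
      moreover have "0 \<le> 1 - exp (- t k * S G)"
        using S t[of k] by simp
      ultimately have "\<bar>(1 - exp (- t k * S G)) / t k\<bar> \<le> S G"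
        using t[of k] by (simp add: field_simps)
      then show "norm ((1 - exp (- t k * S G)) / t k * h G) \<le> S G * C"
        unfolding real_norm_def abs_mult using hC S by (intro mult_mono) auto
    qed
  qed measurable
  moreover have "(\<integral>G. (1 - exp (- t k * S G)) / t k * h G \<partial>?M)
      = (1 - (1 + t k) powr (- n)) / t k * (\<integral>G. h G \<partial>?M)" for k
  proof -
    \<comment> \<open>The scale is \<open>s = 1 + t k\<close>, so that \<open>s - 1\<close> is the
      Laplace parameter.\<close>
    have "(\<integral>G. exp (- t k * S G) * h G \<partial>?M) = (1 + t k) powr (- n) * (\<integral>G. h G \<partial>?M)"
      using integral_PiM_gamma_laplace[of A a "1 + t k" h] assms homogeneous t[of k]
      by (simp add: S_def n_def)
    moreover have "(\<integral>G. (1 - exp (- t k * S G)) / t k * h G \<partial>?M)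
        = (\<integral>G. (h G - exp (- t k * S G) * h G) / t k \<partial>?M)"
      by (intro Bochner_Integration.integral_cong) (auto simp: field_simps)
    ultimately show ?thesis
      using h_int tilt_int by (simp add: left_diff_distrib)
  qed
  moreover have "(\<lambda>k. (1 - (1 + t k) powr (- n)) / t k * (\<integral>G. h G \<partial>?M)) \<longlonglongrightarrow> n * (\<integral>G. h G \<partial>?M)"
  proof (rule tendsto_mult_right)
    have "((\<lambda>t. - ((1 + t) powr (- n))) has_real_derivative n) (at 0)"
      by (auto intro!: derivative_eq_intros)
    from difference_quotient_sequentially[OF this]
    show "(\<lambda>k. (1 - (1 + t k) powr (- n)) / t k) \<longlonglongrightarrow> n" by (simp add: t_def)
  qed
  ultimately have "(\<integral>G. S G * h G \<partial>?M) = n * (\<integral>G. h G \<partial>?M)"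
    by (simp only: LIMSEQ_unique)
  then show ?thesis
    by (simp add: S_def n_def)
qed

section \<open>The Dirichlet law as an image of a gamma product\<close>

text \<open>Names the map inside \<open>dirichlet\<close>, so that its measurability and scale
  invariance can be stated separately.\<close>

definition normalize_on :: "'k set \<Rightarrow> ('k \<Rightarrow> real) \<Rightarrow> real ^ 'k" where
  "normalize_on A G = (\<chi> i. if i \<in> A then G i / (\<Sum>k\<in>A. G k) else 0)"

lemma normalize_on_measurable [measurable]:
  "normalize_on A \<in> borel_measurable (PiM A (\<lambda>_. borel))"
proof -
  have [measurable]: "(\<lambda>G. G i) \<in> borel_measurable (PiM A (\<lambda>_. borel :: real measure))" if "i \<in> A" for i
    using that by (rule measurable_component_singleton)
  have "(\<lambda>G. if i \<in> A then G i / (\<Sum>k\<in>A. G k) else 0 :: real) \<in> borel_measurable (PiM A (\<lambda>_. borel))" for i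
    by (cases "i \<in> A") auto
  then show ?thesis
    by (subst borel_measurable_euclidean_space) (auto simp: Basis_vec_def inner_axis normalize_on_def)
qed

lemma normalize_on_scale:
  "s > 0 \<Longrightarrow> normalize_on A (compose A (\<lambda>x. x / s) G) = normalize_on A G"
  by (auto simp: normalize_on_def compose_def vec_eq_iff simp flip: sum_divide_distrib)

lemma dirichlet_eq_distr:
  "dirichlet \<alpha> = distr (PiM {i. \<alpha> $ i > 0} (\<lambda>i. gamma_measure (\<alpha> $ i))) borel (normalize_on {i. \<alpha> $ i > 0})"
  by (simp add: dirichlet_def Let_def normalize_on_def [abs_def])

lemma sets_dirichlet [simp, measurable_cong]: "sets (dirichlet \<alpha>) = sets borel"
  by (simp add: dirichlet_eq_distr)

lemma space_dirichlet [simp]: "space (dirichlet \<alpha>) = UNIV"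
  by (simp add: dirichlet_eq_distr)

text \<open>The law lives on the whole space, so the bounds come from the almost sure positivity of
  the gamma coordinates. They later supply integrability.\<close>

lemma AE_dirichlet_bounds:
  fixes \<alpha> :: "real ^ 'k"
  shows "AE p in dirichlet \<alpha>. 0 \<le> p $ j \<and> p $ j \<le> 1"
proof -
  let ?A = "{i. \<alpha> $ i > 0}"
  let ?M = "PiM ?A (\<lambda>i. gamma_measure (\<alpha> $ i))"
  have [measurable_cong]: "sets ?M = sets (PiM ?A (\<lambda>_. borel))"
    by (intro sets_PiM_cong) auto
  have "AE G in ?M. \<forall>i\<in>?A. 0 < G i"
    by (rule AE_PiM_gamma_pos) auto
  then have "AE G in ?M. 0 \<le> normalize_on ?A G $ j \<and> normalize_on ?A G $ j \<le> 1"
  proof eventually_elim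
    fix G :: "'k \<Rightarrow> real" assume G: "\<forall>i\<in>?A. 0 < G i"
    show "0 \<le> normalize_on ?A G $ j \<and> normalize_on ?A G $ j \<le> 1"
    proof (cases "j \<in> ?A")
      case True
      with G have "0 < G j" by blast
      moreover have "G j \<le> (\<Sum>k\<in>?A. G k)"
        using True G by (intro member_le_sum) (auto simp: less_imp_le)
      moreover note True
      ultimately show ?thesis by (simp add: normalize_on_def)
    qed (simp add: normalize_on_def)
  qed
  then show ?thesis
    unfolding dirichlet_eq_distr by (subst AE_distr_iff) auto
qed

section \<open>Size biasing and moments of a Dirichlet coordinate\<close>

text \<open>The weight \<open>G j / c $ j\<close> equals the sum of the coordinates times a
  scale-invariant function; \<open>integral_PiM_gamma_sum_mult\<close> then replaces that sum by the
  total of the shapes.\<close>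

lemma integral_dirichlet_add_axis:
  fixes c :: "real ^ 'k" and f :: "real ^ 'k \<Rightarrow> real"
  assumes nonneg: "\<And>i. c $ i \<ge> 0" and pos: "c $ j > 0"
    and f [measurable]: "f \<in> borel_measurable borel"
    and bounded: "AE p in dirichlet c. \<bar>f p\<bar> \<le> C"
  shows "c $ j * (\<integral>p. f p \<partial>dirichlet (c + axis j 1))
    = (\<Sum>i\<in>UNIV. c $ i) * (\<integral>p. p $ j * f p \<partial>dirichlet c)"
proof -
  define A where "A = {i. c $ i > 0}"
  let ?M = "PiM A (\<lambda>i. gamma_measure (c $ i))"
  have [measurable_cong]: "sets ?M = sets (PiM A (\<lambda>_. borel))"
    by (intro sets_PiM_cong) auto
  have jA: "j \<in> A" and cA: "\<And>i. i \<in> A \<Longrightarrow> c $ i > 0"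
    using pos by (auto simp: A_def)
  have [measurable]: "(\<lambda>G. G i) \<in> borel_measurable ?M" if "i \<in> A" for i
    using that by measurable
  have norm_meas: "normalize_on A \<in> borel_measurable ?M"
    by measurable
  note [measurable] = measurable_compose[OF norm_meas f]
    measurable_compose[OF norm_meas borel_measurable_nth]
  have dir: "dirichlet c = distr ?M borel (normalize_on A)"
    by (simp add: dirichlet_eq_distr A_def)
  have upd: "(c + axis j 1) $ i = ((($) c)(j := c $ j + 1)) i" for i
    by (auto simp: axis_def)
  \<comment> \<open>Since \<open>c $ j\<close> is already positive, both laws come from the same
    index set and the same normalisation map.\<close>
  have "{i. (c + axis j 1) $ i > 0} = A"
    using pos by (auto simp: A_def axis_def)
  then have "dirichlet (c + axis j 1)
      = distr (PiM A (\<lambda>i. gamma_measure (((($) c)(j := c $ j + 1)) i))) borel (normalize_on A)"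
    unfolding dirichlet_eq_distr upd by simp
  also have "\<dots> = distr (density ?M (\<lambda>G. ennreal (G j / c $ j))) borel (normalize_on A)"
    using jA cA by (subst PiM_gamma_measure_add_1) auto
  finally have dir': "dirichlet (c + axis j 1)
    = distr (density ?M (\<lambda>G. ennreal (G j / c $ j))) borel (normalize_on A)" .
  have G_pos: "AE G in ?M. \<forall>i\<in>A. 0 < G i"
    using cA by (intro AE_PiM_gamma_pos) auto
  have "c $ j * (\<integral>p. f p \<partial>dirichlet (c + axis j 1))
      = c $ j * (\<integral>G. G j / c $ j * f (normalize_on A G) \<partial>?M)"
    unfolding dir' using G_pos jA pos
    by (subst integral_distr, simp, simp, subst integral_density)
       (auto elim!: eventually_mono intro!: divide_nonneg_pos less_imp_le)
  also have "\<dots> = (\<integral>G. G j * f (normalize_on A G) \<partial>?M)"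
    using pos by simp
  also have "\<dots> = (\<integral>G. (\<Sum>i\<in>A. G i) * (normalize_on A G $ j * f (normalize_on A G)) \<partial>?M)"
  proof (rule integral_cong_AE)
    show "AE G in ?M. G j * f (normalize_on A G)
        = (\<Sum>i\<in>A. G i) * (normalize_on A G $ j * f (normalize_on A G))"
      using G_pos
    proof eventually_elim
      fix G :: "'k \<Rightarrow> real" assume "\<forall>i\<in>A. 0 < G i"
      then have "(\<Sum>i\<in>A. G i) > 0" using jA by (intro sum_pos) auto
      then show "G j * f (normalize_on A G)
          = (\<Sum>i\<in>A. G i) * (normalize_on A G $ j * f (normalize_on A G))"
        using jA by (simp add: normalize_on_def)
    qed
  qed (use jA in measurable)
  also have "\<dots> = (\<Sum>i\<in>A. c $ i) * (\<integral>G. normalize_on A G $ j * f (normalize_on A G) \<partial>?M)"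
  proof (rule integral_PiM_gamma_sum_mult)
    have "AE p in dirichlet c. \<bar>p $ j * f p\<bar> \<le> C"
      using bounded AE_dirichlet_bounds[of j c]
    proof eventually_elim
      fix p assume "\<bar>f p\<bar> \<le> C" "0 \<le> p $ j \<and> p $ j \<le> 1"
      then have "\<bar>p $ j\<bar> * \<bar>f p\<bar> \<le> 1 * C" by (intro mult_mono) auto
      then show "\<bar>p $ j * f p\<bar> \<le> C" by (simp add: abs_mult)
    qed
    then show "AE G in ?M. \<bar>normalize_on A G $ j * f (normalize_on A G)\<bar> \<le> C"
      unfolding dir by (subst (asm) AE_distr_iff) auto
  qed (use cA in \<open>auto simp: normalize_on_scale\<close>)
  also have "(\<integral>G. normalize_on A G $ j * f (normalize_on A G) \<partial>?M) = (\<integral>p. p $ j * f p \<partial>dirichlet c)"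
    unfolding dir by (subst integral_distr) auto
  \<comment> \<open>Coordinates outside \<open>A\<close> are 0 by nonnegativity.\<close>
  also have "(\<Sum>i\<in>A. c $ i) = (\<Sum>i\<in>UNIV. c $ i)"
    using nonneg by (intro sum.mono_neutral_left) (auto simp: A_def not_less intro: antisym)
  finally show ?thesis .
qed

text \<open>Size biasing with the test function 1, whose integral under
  \<open>dirichlet (c + axis j 1)\<close> is 1.\<close>

lemma dirichlet_mean:
  fixes c :: "real ^ 'k"
  assumes "\<And>i. c $ i \<ge> 0" "c $ j > 0"
  shows "(\<integral>p. p $ j \<partial>dirichlet c) = c $ j / (\<Sum>i\<in>UNIV. c $ i)"
proof -
  interpret prob_space "dirichlet (c + axis j 1)" by (rule prob_space_dirichlet)
  have "(\<Sum>i\<in>UNIV. c $ i) > 0"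
    using assms by (intro sum_pos2[of _ j]) auto
  then show ?thesis
    using integral_dirichlet_add_axis[OF assms, of "\<lambda>_. 1" 1] prob_space
    by (simp add: field_simps)
qed

text \<open>Size biasing with the test function \<open>p $ j\<close> reduces this to the mean under
  \<open>c + axis j 1\<close>, where the shape at \<open>j\<close> and the total have both grown by
  1.\<close>

lemma dirichlet_second_moment:
  fixes c :: "real ^ 'k"
  assumes nonneg: "\<And>i. c $ i \<ge> 0" and pos: "c $ j > 0"
  defines "n \<equiv> (\<Sum>i\<in>UNIV. c $ i)"
  shows "(\<integral>p. (p $ j)\<^sup>2 \<partial>dirichlet c) = c $ j * (c $ j + 1) / (n * (n + 1))"
proof -
  have "n > 0"
    unfolding n_def using assms by (intro sum_pos2[of _ j]) auto
  have "(\<integral>p. p $ j \<partial>dirichlet (c + axis j 1)) = (c $ j + 1) / (n + 1)"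
    using nonneg pos
    by (subst dirichlet_mean) (auto simp: axis_def n_def sum.distrib add_nonneg_nonneg)
  moreover have "c $ j * (\<integral>p. p $ j \<partial>dirichlet (c + axis j 1)) = n * (\<integral>p. p $ j * p $ j \<partial>dirichlet c)"
    unfolding n_def using AE_dirichlet_bounds[of j c]
    by (intro integral_dirichlet_add_axis[where C = 1] nonneg pos) (auto elim: eventually_mono)
  ultimately have "n * (\<integral>p. (p $ j)\<^sup>2 \<partial>dirichlet c) = c $ j * ((c $ j + 1) / (n + 1))"
    by (simp add: power2_eq_square)
  then have "(\<integral>p. (p $ j)\<^sup>2 \<partial>dirichlet c) = c $ j * ((c $ j + 1) / (n + 1)) / n"
    using \<open>n > 0\<close> by (simp only: nonzero_eq_divide_eq) (simp add: mult.commute)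
  then show ?thesis
    by (simp add: mult.commute)
qed

section \<open>The total variation bound\<close>

text \<open>Subtracting \<open>Z x / 2\<close> keeps the integral, as \<open>Z\<close> is centred,
  and leaves plus or minus \<open>Z x / 2\<close>. This gains the factor 1/2 over applying
  Cauchy-Schwarz directly to \<open>Z\<close> and the indicator.\<close>

lemma (in prob_space) integral_centred_le_half_sqrt:
  fixes Z :: "'a \<Rightarrow> real"
  assumes Z: "integrable M Z" and Z2: "integrable M (\<lambda>x. (Z x)\<^sup>2)"
    and centred: "expectation Z = 0" and B [measurable]: "B \<in> events"
  shows "\<bar>\<integral>x. Z x * indicator B x \<partial>M\<bar> \<le> 1 / 2 * sqrt (expectation (\<lambda>x. (Z x)\<^sup>2))"
proof -
  define W where "W x = Z x * indicator B x - Z x / 2" for x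
  have W_sq: "(W x)\<^sup>2 = (Z x)\<^sup>2 / 4" for x
    by (auto simp: W_def indicator_def power2_eq_square field_simps)
  have ZB: "integrable M (\<lambda>x. Z x * indicator B x)"
    using integrable_mult_indicator[OF B Z] by (simp add: mult.commute)
  then have W: "integrable M W"
    unfolding W_def using Z by simp
  have EW: "expectation W = (\<integral>x. Z x * indicator B x \<partial>M)"
    unfolding W_def using ZB Z centred by simp
  \<comment> \<open>Nonnegativity of the variance of \<open>W\<close> serves as the Cauchy-Schwarz
    inequality.\<close>
  have "(expectation W)\<^sup>2 \<le> expectation (\<lambda>x. (W x)\<^sup>2)"
    using variance_positive[of W] variance_eq[of W] W Z2 by (simp add: W_sq)
  then have "\<bar>expectation W\<bar> \<le> sqrt (expectation (\<lambda>x. (Z x)\<^sup>2) / 4)"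
    by (intro real_le_rsqrt) (simp add: W_sq)
  then show ?thesis
    by (simp add: EW real_sqrt_divide)
qed

theorem lemma3:
  fixes c :: "real ^ 'k" and j :: 'k and n m :: real
  assumes "\<And>i. c $ i \<ge> 0"
    and "n = (\<Sum>i\<in>UNIV. c $ i)"
    and "c $ j = m"
    and "m > 0"
  shows "tv_dist (dirichlet c) (dirichlet (c + axis j 1)) \<le> 1 / 2 * sqrt ((n - m) / (m * (n + 1)))
    \<and> 1 / 2 * sqrt ((n - m) / (m * (n + 1))) \<le> 1 / (2 * sqrt m)"
proof
  have "m \<le> n"
    unfolding assms(2) assms(3)[symmetric] using assms(1) by (intro member_le_sum) auto
  then have "n > 0" using \<open>m > 0\<close> by simp
  \<comment> \<open>The second inequality rests on \<open>n - m \<le> n + 1\<close>.\<close>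
  have "(n - m) / (n + 1) / m \<le> 1 / m"
    using \<open>m > 0\<close> \<open>n > 0\<close> by (intro divide_right_mono) auto
  then have "(n - m) / (m * (n + 1)) \<le> 1 / m"
    by (simp add: mult.commute)
  then have "sqrt ((n - m) / (m * (n + 1))) \<le> sqrt (1 / m)"
    by (rule real_sqrt_le_mono)
  then show "1 / 2 * sqrt ((n - m) / (m * (n + 1))) \<le> 1 / (2 * sqrt m)"
    by (simp add: real_sqrt_divide)

  interpret D: prob_space "dirichlet c" by (rule prob_space_dirichlet)
  interpret D': prob_space "dirichlet (c + axis j 1)" by (rule prob_space_dirichlet)
  have cj: "c $ j > 0" using assms by simp
  \<comment> \<open>\<open>Z\<close> is 1 minus the density of
    \<open>dirichlet (c + axis j 1)\<close> with respect to \<open>dirichlet c\<close>.\<close>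
  define Z where "Z p = 1 - n / m * p $ j" for p :: "real ^ 'k"
  have P: "integrable (dirichlet c) (\<lambda>p. p $ j)"
    using AE_dirichlet_bounds[of j c]
    by (intro D.integrable_const_bound[where B = 1]) (auto elim: eventually_mono)
  have P2: "integrable (dirichlet c) (\<lambda>p. (p $ j)\<^sup>2)"
    using AE_dirichlet_bounds[of j c]
    by (intro D.integrable_const_bound[where B = 1]) (auto simp: abs_square_le_1 elim: eventually_mono)
  have Z_sq: "(Z p)\<^sup>2 = 1 - 2 * n / m * p $ j + (n / m)\<^sup>2 * (p $ j)\<^sup>2" for p
    by (simp add: Z_def power2_eq_square algebra_simps)
  have Z_int: "integrable (dirichlet c) Z" and Z2_int: "integrable (dirichlet c) (\<lambda>p. (Z p)\<^sup>2)"
    unfolding Z_sq using P P2 by (simp_all add: Z_def [abs_def])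
  have mean: "(\<integral>p. p $ j \<partial>dirichlet c) = m / n"
    using dirichlet_mean[OF assms(1) cj] assms(2,3) by simp
  have moment2: "(\<integral>p. (p $ j)\<^sup>2 \<partial>dirichlet c) = m * (m + 1) / (n * (n + 1))"
    using dirichlet_second_moment[OF assms(1) cj] assms(2,3) by simp
  have "D.expectation Z = 1 - n / m * (m / n)"
    unfolding Z_def using P mean D.prob_space by simp
  then have centred: "D.expectation Z = 0"
    using \<open>m > 0\<close> \<open>n > 0\<close> by simp
  have "D.expectation (\<lambda>p. (Z p)\<^sup>2)
      = 1 - 2 * n / m * (m / n) + (n / m)\<^sup>2 * (m * (m + 1) / (n * (n + 1)))"
    unfolding Z_sq using P P2 mean moment2 D.prob_space by simp
  also have "\<dots> = (n - m) / (m * (n + 1))"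
    using \<open>m > 0\<close> \<open>n > 0\<close> by (simp add: divide_simps power2_eq_square) (simp add: algebra_simps)
  finally have var: "D.expectation (\<lambda>p. (Z p)\<^sup>2) = (n - m) / (m * (n + 1))" .

  show "tv_dist (dirichlet c) (dirichlet (c + axis j 1)) \<le> 1 / 2 * sqrt ((n - m) / (m * (n + 1)))"
    unfolding tv_dist_def
  proof (rule cSUP_least)
    fix B assume "B \<in> sets (dirichlet c)"
    then have [measurable]: "B \<in> sets borel" by simp
    \<comment> \<open>Size biasing with the indicator of \<open>B\<close> as test function.\<close>
    have "m * (\<integral>p. indicator B p \<partial>dirichlet (c + axis j 1))
        = n * (\<integral>p. p $ j * indicator B p \<partial>dirichlet c)"
      unfolding assms(2) assms(3)[symmetric]
      by (intro integral_dirichlet_add_axis[where C = 1] assms(1) cj) (auto simp: indicator_def)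
    then have B': "measure (dirichlet (c + axis j 1)) B = n / m * (\<integral>p. p $ j * indicator B p \<partial>dirichlet c)"
      using \<open>m > 0\<close> by (simp add: field_simps)
    have PB: "integrable (dirichlet c) (\<lambda>p. p $ j * indicator B p)"
      using integrable_mult_indicator[OF _ P, of B] by (simp add: mult.commute)
    \<comment> \<open>The difference of the two probabilities of \<open>B\<close> is the integral of
      \<open>Z\<close> over \<open>B\<close>, to which the bound for centred variables
      applies.\<close>
    have "(\<integral>p. Z p * indicator B p \<partial>dirichlet c)
        = (\<integral>p. indicator B p - n / m * (p $ j * indicator B p) \<partial>dirichlet c)"
      by (simp add: Z_def left_diff_distrib mult.assoc)
    also have "\<dots> = measure (dirichlet c) B - measure (dirichlet (c + axis j 1)) B"
    proof -
      have "integrable (dirichlet c) (indicator B :: _ \<Rightarrow> real)"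
        by (simp add: D.emeasure_eq_measure)
      then show ?thesis
        unfolding B' using PB by (subst Bochner_Integration.integral_diff) auto
    qed
    finally show "\<bar>measure (dirichlet c) B - measure (dirichlet (c + axis j 1)) B\<bar>
        \<le> 1 / 2 * sqrt ((n - m) / (m * (n + 1)))"
      using D.integral_centred_le_half_sqrt[OF Z_int Z2_int centred, of B] var by simp
  qed auto
qed

end
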